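(* Suppose the estimator satisfies the estimation-error assumption and the solver satisfies the solver assumption (both stated in the context). Assume $\Phi^* := \inf_x \Phi(x) > -\infty$. Fix $M>5 l_f L_g$. For any $\Delta \in (0,1)$ and $\epsilon >0$, with probability at least $1- \Delta$, the iterates of the algorithm described in the context satisfy $$\frac{1}{\Sigma_\tau} \sum_{k=0}^{K-1} \sum_{i=0}^{\tau_k -1} \| \mathcal{G}_M(x_i^k) \|_2 ^2 \le \epsilon ,$$ provided the parameters $K, \boldsymbol{\tau}, \theta, \overline{\epsilon}, \overline{\delta}$ satisfy all of the following, where $\tau_{\max}=\max\{\tau_0,\dots,\tau_{K-1}\}$: \begin{align*} \theta &\in \mathcal{C}(K, \boldsymbol{\tau}, \Delta /2 ) ,\\ \overline{\delta} &\le \Delta/(2 \Sigma_\tau ) ,\\ \overline{\epsilon} &\le \epsilon/(5\cdot 30M) ,\\ \Sigma_\tau &\ge 5\cdot 30M (\Phi(x_0^0) - \Phi^* ) / \epsilon ,\\ \gamma_0(K, \boldsymbol{\tau}, \theta, \Delta/2 ) &\le \epsilon/(5\cdot 125\, l_f M) ,\\ \lambda_0^2(K, \boldsymbol{\tau}, \theta, \Delta/2 ) &\le L_g \epsilon/(5\cdot 95\, l_f M) ,\\ \tau_{\max}^2\, \gamma_1^2(K, \boldsymbol{\tau}, \theta, \Delta/2 ) &\le L_g \epsilon/(5\cdot 135\, l_f M) , \\ \tau_{\max}^2\, \gamma_2(K, \boldsymbol{\tau}, \theta, \Delta/2 ) &\le 6 L_g /25 ,\\ \tau_{\max}^2\,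 \lambda_1^2(K, \boldsymbol{\tau}, \theta, \Delta/2 ) &\le 6 L_g^2 /19 . \end{align*}
   Context: Problem. $f:\mathbb{R}^m\to\mathbb{R}$ is convex and $l_f$-Lipschitz; $g:\mathbb{R}^n\to\mathbb{R}^m$ is differentiable and $l_g$-Lipschitz, with Jacobian $g':\mathbb{R}^n\to\mathbb{R}^{m\times n}$ satisfying $\|g'(x)-g'(y)\|_{\mathrm{op}}\le L_g\|x-y\|_2$ for all $x,y$ ($\|\cdot\|_{\mathrm{op}}$ is the spectral norm); $h:\mathbb{R}^n\to\mathbb{R}\cup\{+\infty\}$ is closed, convex and proper; $l_f,L_g>0$. The objective is $\Phi(x)=f(g(x))+h(x)$. Stationarity measure. For $M>0$, $\mathcal{G}_M(x)=M(x-x_+)$, where $x_+=\operatorname{argmin}_{y\in\mathbb{R}^n}\{f(g(x)+g'(x)(y-x))+h(y)+\frac{M}{2}\|y-x\|_2^2\}$. Algorithm. Inputs: $x_0^0\in\mathbb{R}^n$, $M>0$, $K\in\mathbb{N}_+$, $\boldsymbol{\tau}=(\tau_0,\dots,\tau_{K-1})\in\mathbb{N}_+^K$, a (random) estimator with parameter $\theta$ in some parameter space $\Theta$, a (possibly random) solver, tolerances $\overline{\epsilon},\overline{\delta}>0$. For $k=0,\dots,K-1$: for $i=0,\dots,\tau_k-1$, (1) compute random estimates $(\widetilde g_i^k,\widetilde J_i^k)\in\mathbb{R}^m\times\mathbb{R}^{m\times n}$ of $g(x_i^k)$ and $g'(x_i^k)$ by $\mathtt{estimator}(x_i^k,i;\theta)$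 (which may depend on $i$ but not on $k$, and may use the memory of $x_0^k$ and of component evaluations made there); (2) with $s_i^k(x)=f(\widetilde g_i^k+\widetilde J_i^k(x-x_i^k))+h(x)+\frac{M}{2}\|x-x_i^k\|_2^2$, set $x_{i+1}^k=\mathtt{solver}(s_i^k,\overline{\epsilon},\overline{\delta})$. After the inner loop set $x_0^{k+1}=x_{\tau_k}^k$. Notation: $\Sigma_\tau=\sum_{k=0}^{K-1}\tau_k$ and $\mathcal{I}(K,\boldsymbol{\tau})=\{(k,i)\in\mathbb{N}^2:0\le k\le K-1,\ 0\le i\le\tau_k-1\}$. Estimation-error assumption. There exist five non-negative functions $\gamma_0,\gamma_1,\gamma_2,\lambda_0,\lambda_1$ of $(K,\boldsymbol{\tau},\theta,\Delta)$ such that for any $K\in\mathbb{N}_+$, $\boldsymbol{\tau}\in\mathbb{N}_+^K$ and $\Delta\in(0,1)$ there is a set $\mathcal{C}(K,\boldsymbol{\tau},\Delta)\subseteq\Theta$ such that for any $\theta\in\mathcal{C}(K,\boldsymbol{\tau},\Delta)$, with probability at least $1-\Delta$, simultaneously for all $(k,i)\in\mathcal{I}(K,\boldsymbol{\tau})$: $\|\widetilde g_i^k-g(x_i^k)\|_2\le\gamma_0+\gamma_1\|x_i^k-x_0^k\|_2+\gamma_2\|x_i^k-x_0^k\|_2^2$ and $\|\widetilde J_i^k-g'(x_i^k)\|_{\mathrm{op}}\le\lambda_0+\lambda_1\|x_i^k-x_0^k\|_2$, all functions being evaluated at $(K,\boldsymbol{\tau},\theta,\Delta)$. Solver assumption.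 For $\overline{\epsilon},\overline{\delta}>0$ and the problem $\min_x s(x)$, with probability at least $1-\overline{\delta}$, $\mathtt{solver}(s,\overline{\epsilon},\overline{\delta})$ returns $x_{\mathrm{sol}}$ with $s(x_{\mathrm{sol}})\le\inf_x s(x)+\overline{\epsilon}$; this applies to each subproblem $s=s_i^k$ generated by the algorithm. *)

theory Defs
  imports "HOL-Probability.Probability"
begin

section \<open>The composite problem\<close>

definition epi :: "('a \<Rightarrow> ereal) \<Rightarrow> ('a \<times> real) set" where
  "epi h = {(x, t). h x \<le> ereal t}"

definition closed_convex_proper :: "('a::real_normed_vector \<Rightarrow> ereal) \<Rightarrow> bool" where
  "closed_convex_proper h \<longleftrightarrow>
     closed (epi h) \<and> convex (epi h) \<and> (\<forall>x. h x \<noteq> -\<infinity>) \<and> (\<exists>x. h x \<noteq> \<infinity>)"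

definition op_norm :: "real ^ 'n ^ 'm \<Rightarrow> real" where
  "op_norm A = onorm (\<lambda>v. A *v v)"

definition composite ::
    "(real ^ 'm \<Rightarrow> real) \<Rightarrow> (real ^ 'n \<Rightarrow> real ^ 'm) \<Rightarrow> (real ^ 'n \<Rightarrow> ereal) \<Rightarrow> real ^ 'n \<Rightarrow> ereal" where
  "composite f g h x = ereal (f (g x)) + h x"

text \<open>The prox-linear model around \<open>x\<close>, as a function of \<open>y\<close>, built from a value \<open>u\<close> and a matrix \<open>A\<close>.
  With \<open>u = g x\<close>, \<open>A = g' x\<close> it is the exact model; with estimates it is the subproblem
  solved by the algorithm.\<close>

definition prox_model ::
    "(real ^ 'm \<Rightarrow> real) \<Rightarrow> (real ^ 'n \<Rightarrow> ereal) \<Rightarrow> real \<Rightarrow> real ^ 'm \<Rightarrow> real ^ 'n ^ 'm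
      \<Rightarrow> real ^ 'n \<Rightarrow> real ^ 'n \<Rightarrow> ereal" where
  "prox_model f h M u A x y =
     ereal (f (u + A *v (y - x))) + h y + ereal (M / 2 * (norm (y - x))\<^sup>2)"

definition grad_map ::
    "(real ^ 'm \<Rightarrow> real) \<Rightarrow> (real ^ 'n \<Rightarrow> real ^ 'm) \<Rightarrow> (real ^ 'n \<Rightarrow> real ^ 'n ^ 'm)
      \<Rightarrow> (real ^ 'n \<Rightarrow> ereal) \<Rightarrow> real \<Rightarrow> real ^ 'n \<Rightarrow> real ^ 'n" where
  "grad_map f g J h M x = M *\<^sub>R (x - arg_min (prox_model f h M (g x) (J x) x) (\<lambda>_. True))"

section \<open>The algorithm\<close>

text \<open>The randomness of the estimator and of the solver enters through seeds: in step \<open>(k, i)\<close> the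
  estimator receives \<open>est_seed k i \<omega>\<close> and the solver receives \<open>sol_seed k i \<omega>\<close>, where \<open>\<omega>\<close> is the
  sample point.  No assumption on the joint law of the seeds is made.  The estimator does not
  see \<open>k\<close>; it sees \<open>i\<close>, the current point, its own seed, and the memory of the current outer
  iteration.  That memory is any record of \<open>x\<^sub>0\<^sup>k\<close> and of what was evaluated there, hence
  a function of \<open>\<theta>\<close>, \<open>x\<^sub>0\<^sup>k\<close> and the seed of step \<open>(k, 0)\<close>.\<close>

record ('w, 'th, 'mem, 'r, 's, 'n, 'm) oracles =
  memory :: "'th \<Rightarrow> real ^ 'n \<Rightarrow> 'r \<Rightarrow> 'mem"
  estimator :: "'th \<Rightarrow> nat \<Rightarrow> 'mem \<Rightarrow> real ^ 'n \<Rightarrow> 'r \<Rightarrow> (real ^ 'm) \<times> (real ^ 'n ^ 'm)"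
  solver :: "(real ^ 'n \<Rightarrow> ereal) \<Rightarrow> real \<Rightarrow> real \<Rightarrow> 's \<Rightarrow> real ^ 'n"
  est_seed :: "nat \<Rightarrow> nat \<Rightarrow> 'w \<Rightarrow> 'r"
  sol_seed :: "nat \<Rightarrow> nat \<Rightarrow> 'w \<Rightarrow> 's"

text \<open>In the next three constants \<open>z\<close> is the start \<open>x\<^sub>0\<^sup>k\<close> of outer iteration \<open>k\<close> and \<open>x\<close> is
  the current point; \<open>eb\<close> and \<open>db\<close> are the solver tolerances.\<close>

definition estimate_at ::
    "('w, 'th, 'mem, 'r, 's, 'n::finite, 'm::finite) oracles \<Rightarrow> 'th \<Rightarrow> 'w \<Rightarrow> nat \<Rightarrow> nat
      \<Rightarrow> real ^ 'n \<Rightarrow> real ^ 'n \<Rightarrow> (real ^ 'm) \<times> (real ^ 'n ^ 'm)" where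
  "estimate_at Or \<theta> \<omega> k i z x =
     estimator Or \<theta> i (memory Or \<theta> z (est_seed Or k 0 \<omega>)) x (est_seed Or k i \<omega>)"

definition subproblem_at ::
    "(real ^ 'm \<Rightarrow> real) \<Rightarrow> (real ^ 'n \<Rightarrow> ereal) \<Rightarrow> real
      \<Rightarrow> ('w, 'th, 'mem, 'r, 's, 'n::finite, 'm::finite) oracles \<Rightarrow> 'th \<Rightarrow> 'w \<Rightarrow> nat \<Rightarrow> nat
      \<Rightarrow> real ^ 'n \<Rightarrow> real ^ 'n \<Rightarrow> real ^ 'n \<Rightarrow> ereal" where
  "subproblem_at f h M Or \<theta> \<omega> k i z x =
     (let (u, A) = estimate_at Or \<theta> \<omega> k i z x in prox_model f h M u A x)"

primrec inner ::
    "(real ^ 'm \<Rightarrow> real) \<Rightarrow> (real ^ 'n \<Rightarrow> ereal) \<Rightarrow> real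
      \<Rightarrow> ('w, 'th, 'mem, 'r, 's, 'n::finite, 'm::finite) oracles \<Rightarrow> real \<Rightarrow> real \<Rightarrow> 'th \<Rightarrow> 'w \<Rightarrow> nat
      \<Rightarrow> real ^ 'n \<Rightarrow> nat \<Rightarrow> real ^ 'n" where
  "inner f h M Or eb db \<theta> \<omega> k z 0 = z"
| "inner f h M Or eb db \<theta> \<omega> k z (Suc i) =
     solver Or (subproblem_at f h M Or \<theta> \<omega> k i z (inner f h M Or eb db \<theta> \<omega> k z i)) eb db
       (sol_seed Or k i \<omega>)"

primrec outer ::
    "(real ^ 'm \<Rightarrow> real) \<Rightarrow> (real ^ 'n \<Rightarrow> ereal) \<Rightarrow> real
      \<Rightarrow> ('w, 'th, 'mem, 'r, 's, 'n::finite, 'm::finite) oracles \<Rightarrow> real \<Rightarrow> real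
      \<Rightarrow> real ^ 'n \<Rightarrow> nat list \<Rightarrow> 'th \<Rightarrow> 'w \<Rightarrow> nat \<Rightarrow> real ^ 'n" where
  "outer f h M Or eb db x00 \<tau> \<theta> \<omega> 0 = x00"
| "outer f h M Or eb db x00 \<tau> \<theta> \<omega> (Suc k) =
     inner f h M Or eb db \<theta> \<omega> k (outer f h M Or eb db x00 \<tau> \<theta> \<omega> k) (\<tau> ! k)"

text \<open>The iterate \<open>x\<^sub>i\<^sup>k\<close>, for \<open>k < K\<close> and \<open>i \<le> \<tau>\<^sub>k\<close>, the estimates computed there, and the
  subproblem formed there.\<close>

definition iterate ::
    "(real ^ 'm \<Rightarrow> real) \<Rightarrow> (real ^ 'n \<Rightarrow> ereal) \<Rightarrow> real
      \<Rightarrow> ('w, 'th, 'mem, 'r, 's, 'n::finite, 'm::finite) oracles \<Rightarrow> real \<Rightarrow> real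
      \<Rightarrow> real ^ 'n \<Rightarrow> nat list \<Rightarrow> 'th \<Rightarrow> 'w \<Rightarrow> nat \<Rightarrow> nat \<Rightarrow> real ^ 'n" where
  "iterate f h M Or eb db x00 \<tau> \<theta> \<omega> k i =
     inner f h M Or eb db \<theta> \<omega> k (outer f h M Or eb db x00 \<tau> \<theta> \<omega> k) i"

definition estimates ::
    "(real ^ 'm \<Rightarrow> real) \<Rightarrow> (real ^ 'n \<Rightarrow> ereal) \<Rightarrow> real
      \<Rightarrow> ('w, 'th, 'mem, 'r, 's, 'n::finite, 'm::finite) oracles \<Rightarrow> real \<Rightarrow> real
      \<Rightarrow> real ^ 'n \<Rightarrow> nat list \<Rightarrow> 'th \<Rightarrow> 'w \<Rightarrow> nat \<Rightarrow> nat \<Rightarrow> (real ^ 'm) \<times> (real ^ 'n ^ 'm)" where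
  "estimates f h M Or eb db x00 \<tau> \<theta> \<omega> k i =
     estimate_at Or \<theta> \<omega> k i
       (iterate f h M Or eb db x00 \<tau> \<theta> \<omega> k 0) (iterate f h M Or eb db x00 \<tau> \<theta> \<omega> k i)"

definition subproblem ::
    "(real ^ 'm \<Rightarrow> real) \<Rightarrow> (real ^ 'n \<Rightarrow> ereal) \<Rightarrow> real
      \<Rightarrow> ('w, 'th, 'mem, 'r, 's, 'n::finite, 'm::finite) oracles \<Rightarrow> real \<Rightarrow> real
      \<Rightarrow> real ^ 'n \<Rightarrow> nat list \<Rightarrow> 'th \<Rightarrow> 'w \<Rightarrow> nat \<Rightarrow> nat \<Rightarrow> real ^ 'n \<Rightarrow> ereal" where
  "subproblem f h M Or eb db x00 \<tau> \<theta> \<omega> k i =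
     subproblem_at f h M Or \<theta> \<omega> k i
       (iterate f h M Or eb db x00 \<tau> \<theta> \<omega> k 0) (iterate f h M Or eb db x00 \<tau> \<theta> \<omega> k i)"

lemma iterate_0_0: "iterate f h M Or eb db x00 \<tau> \<theta> \<omega> 0 0 = x00"
  by (simp add: iterate_def)

lemma iterate_Suc_0:
  "iterate f h M Or eb db x00 \<tau> \<theta> \<omega> (Suc k) 0 = iterate f h M Or eb db x00 \<tau> \<theta> \<omega> k (\<tau> ! k)"
  by (simp add: iterate_def)

lemma iterate_Suc:
  "iterate f h M Or eb db x00 \<tau> \<theta> \<omega> k (Suc i) =
     solver Or (subproblem f h M Or eb db x00 \<tau> \<theta> \<omega> k i) eb db (sol_seed Or k i \<omega>)"
  by (simp add: iterate_def subproblem_def)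

lemma subproblem_eq:
  "subproblem f h M Or eb db x00 \<tau> \<theta> \<omega> k i =
     (let (u, A) = estimates f h M Or eb db x00 \<tau> \<theta> \<omega> k i
      in prox_model f h M u A (iterate f h M Or eb db x00 \<tau> \<theta> \<omega> k i))"
  by (simp add: subproblem_def subproblem_at_def estimates_def)

definition epoch_lengths :: "nat \<Rightarrow> nat list set" where
  "epoch_lengths K = {\<tau>. length \<tau> = K \<and> (\<forall>t\<in>set \<tau>. 0 < t)}"

definition idx :: "nat \<Rightarrow> nat list \<Rightarrow> (nat \<times> nat) set" where
  "idx K \<tau> = {(k, i). k < K \<and> i < \<tau> ! k}"

section \<open>Assumptions on the estimator and the solver\<close>

text \<open>\<open>Q\<close> holds with probability at least \<open>p\<close>: there is an event of probability at least \<open>p\<close> on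
  which \<open>Q\<close> holds.  This avoids measurability requirements on the estimator and the solver and
  is the usual notion whenever \<open>Q\<close> is measurable.\<close>

definition with_prob_ge :: "'w measure \<Rightarrow> real \<Rightarrow> ('w \<Rightarrow> bool) \<Rightarrow> bool" where
  "with_prob_ge P p Q \<longleftrightarrow> (\<exists>E\<in>sets P. (\<forall>\<omega>\<in>E. Q \<omega>) \<and> p \<le> measure P E)"

lemma with_prob_ge_iff_prob:
  assumes "prob_space P" and "{\<omega> \<in> space P. Q \<omega>} \<in> sets P"
  shows "with_prob_ge P p Q \<longleftrightarrow> p \<le> measure P {\<omega> \<in> space P. Q \<omega>}"
proof -
  interpret prob_space P by fact
  show ?thesis
  proof
    assume "with_prob_ge P p Q"
    then obtain E where E: "E \<in> sets P" "\<forall>\<omega>\<in>E. Q \<omega>" "p \<le> measure P E"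
      by (auto simp: with_prob_ge_def)
    have "E \<subseteq> {\<omega> \<in> space P. Q \<omega>}"
      using E(1,2) sets.sets_into_space by blast
    then have "measure P E \<le> measure P {\<omega> \<in> space P. Q \<omega>}"
      using assms(2) by (rule finite_measure_mono)
    with E(3) show "p \<le> measure P {\<omega> \<in> space P. Q \<omega>}" by simp
  next
    assume "p \<le> measure P {\<omega> \<in> space P. Q \<omega>}"
    with assms(2) show "with_prob_ge P p Q"
      unfolding with_prob_ge_def by (intro bexI[of _ "{\<omega> \<in> space P. Q \<omega>}"]) auto
  qed
qed

definition estimation_error_assumption ::
    "'w measure \<Rightarrow> (real ^ 'm \<Rightarrow> real) \<Rightarrow> (real ^ 'n \<Rightarrow> real ^ 'm) \<Rightarrow> (real ^ 'n \<Rightarrow> real ^ 'n ^ 'm)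
      \<Rightarrow> (real ^ 'n \<Rightarrow> ereal) \<Rightarrow> real \<Rightarrow> ('w, 'th, 'mem, 'r, 's, 'n::finite, 'm::finite) oracles
      \<Rightarrow> real \<Rightarrow> real \<Rightarrow> real ^ 'n \<Rightarrow> 'th set \<Rightarrow> (nat \<Rightarrow> nat list \<Rightarrow> real \<Rightarrow> 'th set)
      \<Rightarrow> (nat \<Rightarrow> nat list \<Rightarrow> 'th \<Rightarrow> real \<Rightarrow> real) \<Rightarrow> (nat \<Rightarrow> nat list \<Rightarrow> 'th \<Rightarrow> real \<Rightarrow> real)
      \<Rightarrow> (nat \<Rightarrow> nat list \<Rightarrow> 'th \<Rightarrow> real \<Rightarrow> real) \<Rightarrow> (nat \<Rightarrow> nat list \<Rightarrow> 'th \<Rightarrow> real \<Rightarrow> real)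
      \<Rightarrow> (nat \<Rightarrow> nat list \<Rightarrow> 'th \<Rightarrow> real \<Rightarrow> real) \<Rightarrow> bool" where
  "estimation_error_assumption P f g J h M Or eb db x00 \<Theta> C \<gamma>0 \<gamma>1 \<gamma>2 lam0 lam1 \<longleftrightarrow>
     (\<forall>K > 0. \<forall>\<tau> \<in> epoch_lengths K. \<forall>\<Delta>. 0 < \<Delta> \<and> \<Delta> < 1 \<longrightarrow>
        (\<forall>\<theta> \<in> \<Theta>. 0 \<le> \<gamma>0 K \<tau> \<theta> \<Delta> \<and> 0 \<le> \<gamma>1 K \<tau> \<theta> \<Delta> \<and> 0 \<le> \<gamma>2 K \<tau> \<theta> \<Delta> \<and>
                 0 \<le> lam0 K \<tau> \<theta> \<Delta> \<and> 0 \<le> lam1 K \<tau> \<theta> \<Delta>) \<and>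
        C K \<tau> \<Delta> \<subseteq> \<Theta> \<and>
        (\<forall>\<theta> \<in> C K \<tau> \<Delta>.
           with_prob_ge P (1 - \<Delta>) (\<lambda>\<omega>. \<forall>(k, i) \<in> idx K \<tau>.
             let x = iterate f h M Or eb db x00 \<tau> \<theta> \<omega> k i;
                 z = iterate f h M Or eb db x00 \<tau> \<theta> \<omega> k 0;
                 (u, A) = estimates f h M Or eb db x00 \<tau> \<theta> \<omega> k i
             in norm (u - g x) \<le> \<gamma>0 K \<tau> \<theta> \<Delta> + \<gamma>1 K \<tau> \<theta> \<Delta> * norm (x - z)
                                  + \<gamma>2 K \<tau> \<theta> \<Delta> * (norm (x - z))\<^sup>2 \<and>
                op_norm (A - J x) \<le> lam0 K \<tau> \<theta> \<Delta> + lam1 K \<tau> \<theta> \<Delta> * norm (x - z))))"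

definition solver_assumption ::
    "'w measure \<Rightarrow> (real ^ 'm \<Rightarrow> real) \<Rightarrow> (real ^ 'n \<Rightarrow> ereal) \<Rightarrow> real
      \<Rightarrow> ('w, 'th, 'mem, 'r, 's, 'n::finite, 'm::finite) oracles \<Rightarrow> real ^ 'n \<Rightarrow> 'th set \<Rightarrow> bool" where
  "solver_assumption P f h M Or x00 \<Theta> \<longleftrightarrow>
     (\<forall>eb > 0. \<forall>db > 0. \<forall>K > 0. \<forall>\<tau> \<in> epoch_lengths K. \<forall>\<theta> \<in> \<Theta>. \<forall>(k, i) \<in> idx K \<tau>.
        with_prob_ge P (1 - db) (\<lambda>\<omega>.
          let s = subproblem f h M Or eb db x00 \<tau> \<theta> \<omega> k i
          in s (solver Or s eb db (sol_seed Or k i \<omega>)) \<le> (INF x. s x) + ereal eb))"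

end

theory Submission
  imports Defs
begin

text \<open>With \<open>D\<close> the distance from \<open>x\<^sub>i\<^sup>k\<close> to its exact prox-linear point and
  \<open>d\<close> the length of the step to \<open>x\<^sub>i\<^sub>+\<^sub>1\<^sup>k\<close>, comparing the inexact subproblem at its approximate
  minimizer with its value at the exact prox-linear point shows that one step decreases \<open>\<Phi>\<close> by a
  multiple of \<open>D\<^sup>2 + d\<^sup>2\<close>, up to the solver tolerance and errors that are linear in \<open>D\<close>
  and \<open>d\<close>.  Young's inequality turns the estimation errors into constants of order \<open>\<epsilon> / M\<close>, small
  multiples of \<open>D\<^sup>2\<close> and \<open>d\<^sup>2\<close>, and a multiple of the squared drift from the start of the
  epoch.  By Cauchy-Schwarz the drift is, summed over an epoch of length at most \<open>T\<close>, at most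
  \<open>T\<^sup>2 / 2\<close> times the sum of the \<open>d\<^sup>2\<close>, so that the negative \<open>d\<^sup>2\<close> terms absorb it; this is
  where the factors \<open>\<tau>\<^sub>m\<^sub>a\<^sub>x\<close> in the hypotheses come from.  Telescoping bounds
  the sum of the \<open>D\<^sup>2\<close>, and a union bound over the solver calls gives the probability.\<close>

section \<open>Combining events of high probability\<close>

text \<open>Inclusion-exclusion: \<open>prob (A \<inter> B)\<close> equals
  \<open>prob A + prob B - prob (A \<union> B)\<close>, and the last probability is at most 1. The
  two events may depend on each other arbitrarily.\<close>

lemma with_prob_ge_conj:
  assumes "prob_space P" and "with_prob_ge P p Q" and "with_prob_ge P q R"
  shows "with_prob_ge P (p + q - 1) (\<lambda>\<omega>. Q \<omega> \<and> R \<omega>)"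
proof -
  interpret prob_space P by fact
  obtain A where A: "A \<in> sets P" "\<forall>\<omega>\<in>A. Q \<omega>" "p \<le> prob A"
    using assms(2) by (auto simp: with_prob_ge_def)
  obtain B where B: "B \<in> sets P" "\<forall>\<omega>\<in>B. R \<omega>" "q \<le> prob B"
    using assms(3) by (auto simp: with_prob_ge_def)
  have "prob (A \<union> B) = prob A + prob B - prob (A \<inter> B)"
    using A(1) B(1) finite_measure_Union'[of A B] finite_measure_Diff'[of B A]
    by (simp add: Int_commute)
  then have "p + q - 1 \<le> prob (A \<inter> B)"
    using A(3) B(3) prob_le_1[of "A \<union> B"] by linarith
  then show ?thesis
    unfolding with_prob_ge_def using A(1,2) B(1,2) by (intro bexI[of _ "A \<inter> B"]) auto
qed

text \<open>Union bound: each further conjunct costs another \<delta>.\<close>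

lemma with_prob_ge_Ball:
  assumes "prob_space P" and "finite I" and "\<And>i. i \<in> I \<Longrightarrow> with_prob_ge P (1 - \<delta>) (Q i)"
  shows "with_prob_ge P (1 - real (card I) * \<delta>) (\<lambda>\<omega>. \<forall>i\<in>I. Q i \<omega>)"
  using assms(2,3)
proof (induction I rule: finite_induct)
  case empty
  interpret prob_space P by fact
  show ?case
    unfolding with_prob_ge_def by (intro bexI[of _ "space P"]) (auto simp: prob_space)
next
  case (insert i I)
  have "with_prob_ge P ((1 - \<delta>) + (1 - real (card I) * \<delta>) - 1) (\<lambda>\<omega>. Q i \<omega> \<and> (\<forall>i\<in>I. Q i \<omega>))"
    using insert by (intro with_prob_ge_conj assms(1)) auto
  then show ?case
    using insert.hyps by (simp add: algebra_simps)
qed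

lemma with_prob_ge_mono:
  assumes "with_prob_ge P p Q" and "q \<le> p" and "\<And>\<omega>. Q \<omega> \<Longrightarrow> R \<omega>"
  shows "with_prob_ge P q R"
  using assms unfolding with_prob_ge_def by (meson order_trans)

section \<open>Operator norm and convexity\<close>

lemma norm_mult_vec_le: "norm (A *v v) \<le> op_norm A * norm v"
  unfolding op_norm_def by (rule onorm) (rule matrix_vector_mul_bounded_linear)

lemma op_norm_nonneg: "0 \<le> op_norm A"
  unfolding op_norm_def by (rule onorm_pos_le) (rule matrix_vector_mul_bounded_linear)

text \<open>Convexity is encoded in the epigraph, so the bound is read off the midpoint of
  \<open>(a, s)\<close> and \<open>(b, t)\<close>.\<close>

lemma closed_convex_proper_midpoint:
  assumes "closed_convex_proper h" and "h a = ereal s" and "h b = ereal t"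
  shows "h ((1/2) *\<^sub>R a + (1/2) *\<^sub>R b) \<le> ereal ((s + t) / 2)"
proof -
  have "convex (epi h)" and "(a, s) \<in> epi h" and "(b, t) \<in> epi h"
    using assms by (auto simp: closed_convex_proper_def epi_def)
  then have "(1/2) *\<^sub>R (a, s) + (1/2) *\<^sub>R (b, t) \<in> epi h"
    by (intro convexD) auto
  then show ?thesis
    by (simp add: epi_def add_divide_distrib)
qed

section \<open>Drift within an epoch\<close>

lemma norm_sum_squared_le:
  fixes a :: "nat \<Rightarrow> 'a::real_normed_vector"
  shows "(norm (\<Sum>j<n. a j))\<^sup>2 \<le> real n * (\<Sum>j<n. (norm (a j))\<^sup>2)"
proof -
  have "(norm (\<Sum>j<n. a j))\<^sup>2 \<le> (\<Sum>j<n. norm (a j))\<^sup>2"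
    by (intro power_mono norm_sum) simp
  also have "\<dots> \<le> (\<Sum>j<n. (norm (a j))\<^sup>2) * (\<Sum>j<n. 1\<^sup>2)"
    using Cauchy_Schwarz_ineq_sum[of "\<lambda>j. norm (a j)" "\<lambda>_. 1" "{..<n}"] by simp
  finally show ?thesis by (simp add: mult.commute)
qed

text \<open>The displacement \<open>x i - x 0\<close> telescopes into \<open>i\<close> steps, so its
  square is at most \<open>i\<close> times the sum of the squared steps. Summing
  \<open>2 * i\<close> over \<open>i < n\<close> gives \<open>n * (n - 1)\<close>, at most the
  square of \<open>n\<close>.\<close>

lemma sum_drift_le:
  fixes x :: "nat \<Rightarrow> 'a::real_normed_vector"
  shows "(\<Sum>i<n. 2 * (norm (x i - x 0))\<^sup>2)
    \<le> (real n)\<^sup>2 * (\<Sum>i<n. (norm (x (Suc i) - x i))\<^sup>2)" (is "_ \<le> _ * ?S n")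
proof -
  have "2 * (norm (x i - x 0))\<^sup>2 \<le> 2 * real i * ?S n" if "i < n" for i
  proof -
    have "(norm (x i - x 0))\<^sup>2 \<le> real i * ?S i"
      using norm_sum_squared_le[of "\<lambda>j. x (Suc j) - x j" i] by (simp add: sum_lessThan_telescope)
    also have "\<dots> \<le> real i * ?S n"
      using that by (intro mult_left_mono sum_mono2) auto
    finally show ?thesis by simp
  qed
  then have "(\<Sum>i<n. 2 * (norm (x i - x 0))\<^sup>2) \<le> (\<Sum>i<n. 2 * real i * ?S n)"
    by (intro sum_mono) auto
  also have "\<dots> = (\<Sum>i<n. 2 * real i) * ?S n"
    by (simp add: sum_distrib_right)
  also have "(\<Sum>i<n. 2 * real i) = real n * (real n - 1)"
    by (induction n) (auto simp: algebra_simps)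
  also have "real n * (real n - 1) * ?S n \<le> (real n)\<^sup>2 * ?S n"
    by (intro mult_right_mono sum_nonneg) (auto simp: power2_eq_square algebra_simps)
  finally show ?thesis .
qed

text \<open>Summing the steps telescopes \<open>\<phi>\<close>. By \<open>sum_drift_le\<close> and
  \<open>real n \<le> T\<close>, the brackets multiplied by \<open>L\<close> have a nonpositive sum,
  although a single one may be positive.\<close>

lemma epoch_descent:
  fixes x :: "nat \<Rightarrow> 'a::real_normed_vector"
  assumes step: "\<And>i. i < n \<Longrightarrow> \<phi> (Suc i) \<le> \<phi> i + c - b i
      + L * (2 * (norm (x i - x 0))\<^sup>2 / T\<^sup>2 - (norm (x (Suc i) - x i))\<^sup>2)"
    and "0 \<le> L" and "real n \<le> T"
  shows "\<phi> n + (\<Sum>i<n. b i) \<le> \<phi> 0 + real n * c"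
\<comment> \<open>A nonempty epoch forces \<open>T > 0\<close>, as the division by
  \<open>T\<^sup>2\<close> requires.\<close>
proof (cases "n = 0")
  case False
  let ?r = "\<Sum>i<n. 2 * (norm (x i - x 0))\<^sup>2"
  let ?d = "\<Sum>i<n. (norm (x (Suc i) - x i))\<^sup>2"
  have T: "0 < T" using False assms(3) by linarith
  have "?r \<le> (real n)\<^sup>2 * ?d"
    by (rule sum_drift_le)
  also have "\<dots> \<le> T\<^sup>2 * ?d"
    using assms(3) by (intro mult_right_mono power_mono sum_nonneg) auto
  finally have "?r / T\<^sup>2 \<le> ?d"
    using T by (simp add: divide_le_eq mult.commute)
  then have drift: "L * (?r / T\<^sup>2 - ?d) \<le> 0"
    using assms(2) by (simp add: mult_nonneg_nonpos)
  have "\<phi> n - \<phi> 0 = (\<Sum>i<n. \<phi> (Suc i) - \<phi> i)"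
    by (simp add: sum_lessThan_telescope)
  also have "\<dots> \<le> (\<Sum>i<n. c - b i
      + L * (2 * (norm (x i - x 0))\<^sup>2 / T\<^sup>2 - (norm (x (Suc i) - x i))\<^sup>2))"
    using step by (intro sum_mono) (force simp: algebra_simps)
  also have "\<dots> = real n * c - (\<Sum>i<n. b i) + L * (?r / T\<^sup>2 - ?d)"
    by (simp add: sum.distrib sum_subtractf flip: sum_distrib_left sum_divide_distrib)
  finally show ?thesis using drift by linarith
qed simp

section \<open>Absorbing the estimation errors\<close>

lemma young: "a * b \<le> a\<^sup>2 / c + c * b\<^sup>2 / 4" if "0 < c" for a b c :: real
proof -
  have "a\<^sup>2 / c + c * b\<^sup>2 / 4 - a * b = (a - c * b / 2)\<^sup>2 / c"
    using that by (simp add: field_simps power2_eq_square)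
  also have "\<dots> \<ge> 0" using that by simp
  finally show ?thesis by simp
qed

text \<open>Every product other than the \<open>c2\<close> term is split by \<open>young\<close>
  with weight \<open>Lg\<close>. The coefficients of \<open>Lg * r\<^sup>2 / T\<^sup>2\<close> add
  up to 1/2 + 12/25 + 12/19 < 2. The squares of \<open>d\<close> and \<open>D\<close> each receive
  1/4 from \<open>l0\<close> and 1/4 from \<open>l1\<close>.\<close>

lemma error_terms_le:
  fixes Lg T r d D :: real
  assumes "0 < Lg" and "0 < T" and "T\<^sup>2 * c2 \<le> 6 * Lg / 25" and "T\<^sup>2 * l1\<^sup>2 \<le> 6 * Lg\<^sup>2 / 19"
  shows "2 * (c0 + c1 * r + c2 * r\<^sup>2) + (l0 + l1 * r) * (d + D)
    \<le> 2 * c0 + 2 * (T\<^sup>2 * c1\<^sup>2) / Lg + 2 * l0\<^sup>2 / Lg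
      + Lg * (2 * r\<^sup>2 / T\<^sup>2 + d\<^sup>2 / 2 + D\<^sup>2 / 2)"
proof -
  define q where "q = r\<^sup>2 / T\<^sup>2"
  have r: "r\<^sup>2 = T\<^sup>2 * q" and q: "0 \<le> q" using assms(2) by (auto simp: q_def)
  \<comment> \<open>Rescaling by \<open>T\<close> makes \<open>young\<close> produce
    \<open>T\<^sup>2 * c1\<^sup>2\<close>, the quantity that the theorem bounds, and the normalized
    drift \<open>q\<close>.\<close>
  have "c1 * r = (T * c1) * (r / T)" using assms(2) by simp
  also have "\<dots> \<le> (T * c1)\<^sup>2 / Lg + Lg * (r / T)\<^sup>2 / 4"
    by (rule young[OF assms(1)])
  finally have 1: "c1 * r \<le> T\<^sup>2 * c1\<^sup>2 / Lg + Lg * q / 4"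
    by (simp add: q_def power_mult_distrib power_divide)
  have "c2 * r\<^sup>2 = (T\<^sup>2 * c2) * q" by (simp add: r)
  also have "\<dots> \<le> 6 * Lg / 25 * q" using assms(3) q by (rule mult_right_mono)
  finally have 2: "c2 * r\<^sup>2 \<le> 6 / 25 * (Lg * q)" by simp
  have "(l1 * r)\<^sup>2 / Lg = (T\<^sup>2 * l1\<^sup>2) * q / Lg"
    by (simp add: r power_mult_distrib)
  also have "\<dots> \<le> (6 * Lg\<^sup>2 / 19) * q / Lg"
    using assms(1,4) q by (intro divide_right_mono mult_right_mono) auto
  also have "\<dots> = 6 / 19 * (Lg * q)" using assms(1) by (simp add: power2_eq_square)
  finally have "(l1 * r)\<^sup>2 / Lg \<le> 6 / 19 * (Lg * q)" .
  then have 3: "(l1 * r) * s \<le> 6 / 19 * (Lg * q) + Lg * s\<^sup>2 / 4" for s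
    using young[OF assms(1), of "l1 * r" s] by linarith
  have 4: "l0 * s \<le> l0\<^sup>2 / Lg + Lg * s\<^sup>2 / 4" for s
    by (rule young[OF assms(1)])
  have "0 \<le> Lg * q" using assms(1) q by simp
  moreover have "2 * r\<^sup>2 / T\<^sup>2 = 2 * q" by (simp add: q_def)
  ultimately show ?thesis
    using 1 2 3[of d] 3[of D] 4[of d] 4[of D] by (simp add: algebra_simps)
qed

section \<open>The deterministic setting\<close>

text \<open>The data without the randomness. \<open>\<phi>star\<close> is a real lower bound of the
  objective; the theorem instantiates it with the infimum.\<close>

locale prox_linear =
  fixes f :: "real ^ 'm \<Rightarrow> real" and g :: "real ^ 'n \<Rightarrow> real ^ 'm"
    and J :: "real ^ 'n \<Rightarrow> real ^ 'n ^ 'm" and h :: "real ^ 'n \<Rightarrow> ereal"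
    and lf lg Lg M \<phi>star :: real
  assumes f_convex: "convex_on UNIV f" and f_lipschitz: "lf-lipschitz_on UNIV f"
    and g_lipschitz: "lg-lipschitz_on UNIV g"
    and g_deriv: "\<And>x. (g has_derivative (\<lambda>v. J x *v v)) (at x)"
    and J_lipschitz: "\<And>x y. op_norm (J x - J y) \<le> Lg * norm (x - y)"
    and h_ccp: "closed_convex_proper h"
    and Lg_pos: "0 < Lg" and M_gt: "5 * lf * Lg < M" and lf_pos: "0 < lf"
    and bounded_below: "\<And>x. ereal \<phi>star \<le> composite f g h x"
begin

lemma M_pos: "0 < M"
  using M_gt Lg_pos lf_pos by (meson mult_pos_pos order_less_trans zero_less_numeral)

lemma f_lipschitzD: "\<bar>f a - f b\<bar> \<le> lf * norm (a - b)"
  using lipschitz_onD[OF f_lipschitz, of a b] by (simp add: dist_norm)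

lemma h_not_MInf: "h x \<noteq> -\<infinity>"
  using h_ccp by (auto simp: closed_convex_proper_def)

lemma h_real: "h x \<noteq> \<infinity> \<Longrightarrow> h x = ereal (real_of_ereal (h x))"
  using h_not_MInf[of x] by (cases "h x") auto

text \<open>Mean value inequality for \<open>g\<close> minus its linearization: on the segment the
  derivative of this difference, \<open>J w - J x\<close>, has norm at most
  \<open>Lg * norm (y - x)\<close>.\<close>

lemma linearization_error: "norm (g y - (g x + J x *v (y - x))) \<le> Lg * (norm (y - x))\<^sup>2"
proof -
  have "norm (g y - g x - J x *v (y - x)) \<le> norm (y - x) * (Lg * norm (y - x))"
  proof (rule differentiable_bound_linearization[where S = "closed_segment x y"])
    show "x + t *\<^sub>R (y - x) \<in> closed_segment x y" if "t \<in> {0..1}" for t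
      using that by (auto simp: in_segment algebra_simps intro!: exI[of _ t])
    show "(g has_derivative (\<lambda>v. J w *v v)) (at w within closed_segment x y)" for w
      using g_deriv by (rule has_derivative_at_withinI)
    show "onorm ((\<lambda>v. J w *v v) - (\<lambda>v. J x *v v)) \<le> Lg * norm (y - x)"
      if "w \<in> closed_segment x y" for w
    proof -
      have "onorm ((\<lambda>v. J w *v v) - (\<lambda>v. J x *v v)) = op_norm (J w - J x)"
        by (simp add: op_norm_def matrix_vector_mult_diff_rdistrib fun_diff_def)
      also have "\<dots> \<le> Lg * norm (w - x)" by (rule J_lipschitz)
      also have "\<dots> \<le> Lg * norm (y - x)"
        using segment_bound(1)[OF that] Lg_pos by (simp add: norm_minus_commute)
      finally show ?thesis .
    qed
  qed simp
  then show ?thesis by (simp add: power2_eq_square algebra_simps)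
qed

section \<open>Existence of the exact prox-linear point\<close>

text \<open>The sum of \<open>f \<circ> g\<close> and \<open>h\<close> is at least
  \<open>\<phi>star\<close>, and \<open>f \<circ> g\<close> grows at most linearly with slope
  \<open>lf * lg\<close>. The quadratic term of the model therefore dominates.\<close>

lemma h_lower_bound: "ereal (\<phi>star - f (g x) - lf * lg * norm (y - x)) \<le> h y"
proof -
  have "f (g y) - f (g x) \<le> lf * norm (g y - g x)"
    using f_lipschitzD[of "g y" "g x"] by linarith
  also have "\<dots> \<le> lf * (lg * norm (y - x))"
    using lipschitz_onD[OF g_lipschitz, of y x] lf_pos by (simp add: dist_norm)
  finally have "f (g y) \<le> f (g x) + lf * lg * norm (y - x)" by simp
  moreover have "ereal \<phi>star \<le> ereal (f (g y)) + h y"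
    using bounded_below[of y] by (simp add: composite_def)
  ultimately show ?thesis by (cases "h y") auto
qed

text \<open>The sublevel sets of the model are compact because \<open>h\<close> is bounded below by
  \<open>\<phi>star - f \<circ> g\<close>, which decreases at most linearly.  Working in the epigraph replaces lower
  semicontinuity of \<open>h\<close> by continuity of \<open>(y, t) \<mapsto> t\<close>.\<close>

lemma prox_model_attains_min:
  "\<exists>p. \<forall>y. prox_model f h M u A x p \<le> prox_model f h M u A x y"
proof -
  define F where "F = (\<lambda>(y, t). f (u + A *v (y - x)) + t + M / 2 * (norm (y - x))\<^sup>2)"
  obtain y0 where "h y0 \<noteq> \<infinity>"
    using h_ccp by (auto simp: closed_convex_proper_def)
  then obtain t0 where t0: "h y0 = ereal t0" using h_real by blast
  define c where "c = F (y0, t0)"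
  define S where "S = epi h \<inter> {p. F p \<le> c}"
  define a where "a = lf * op_norm A"
  define b where "b = a + lf * lg"
  define c' where "c' = c - f u + f (g x) - \<phi>star"
  \<comment> \<open>Beyond this radius \<open>M / 2 * r\<^sup>2\<close> exceeds
    \<open>c' + b * r\<close>. The summand 1 ensures \<open>r > 1\<close> there, so that
    \<open>\<bar>c'\<bar> \<le> \<bar>c'\<bar> * r\<close>.\<close>
  define R where "R = 2 * (\<bar>c'\<bar> + b) / M + 1"
  have a: "0 \<le> a" using lf_pos by (simp add: a_def op_norm_nonneg)
  have lg: "0 \<le> lf * lg" using g_lipschitz lf_pos by (simp add: lipschitz_on_def)
  have b: "0 \<le> b" using a lg by (simp add: b_def)
  have f_lower: "f u - a * norm (y - x) \<le> f (u + A *v (y - x))" for y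
  proof -
    have "f u - f (u + A *v (y - x)) \<le> lf * norm (A *v (y - x))"
      using f_lipschitzD[of u "u + A *v (y - x)"] by simp
    also have "\<dots> \<le> lf * (op_norm A * norm (y - x))"
      using lf_pos by (simp add: norm_mult_vec_le)
    finally show ?thesis by (simp add: a_def)
  qed
  have "S \<subseteq> cball x R \<times> {\<phi>star - f (g x) - lf * lg * R .. c - f u + a * R}"
  proof clarify
    fix y t assume "(y, t) \<in> S"
    then have ht: "h y \<le> ereal t" and Fc: "F (y, t) \<le> c"
      by (auto simp: S_def epi_def)
    define r where "r = norm (y - x)"
    have r: "0 \<le> r" by (simp add: r_def)
    have t_ge: "\<phi>star - f (g x) - lf * lg * r \<le> t"
      using order_trans[OF h_lower_bound ht] by (simp add: r_def)
    have Fc': "f u - a * r + t + M / 2 * r\<^sup>2 \<le> c"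
      using Fc f_lower[of y] by (simp add: F_def r_def)
    then have quad: "M / 2 * r\<^sup>2 \<le> c' + b * r"
      using t_ge by (simp add: c'_def b_def algebra_simps)
    have rR: "r \<le> R"
    proof (rule ccontr)
      assume "\<not> r \<le> R"
      then have big: "2 * (\<bar>c'\<bar> + b) / M + 1 < r" by (simp add: R_def)
      have "0 \<le> 2 * (\<bar>c'\<bar> + b) / M" using b M_pos by simp
      with big have r1: "1 < r" by linarith
      have "2 * (\<bar>c'\<bar> + b) < M * r"
        using big M_pos by (simp add: field_simps)
      then have "\<bar>c'\<bar> + b < M / 2 * r" by simp
      then have "(\<bar>c'\<bar> + b) * r < M / 2 * r * r"
        using r1 by (intro mult_strict_right_mono) auto
      moreover have "\<bar>c'\<bar> \<le> \<bar>c'\<bar> * r" using r1 by (simp add: mult_le_cancel_left1)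
      ultimately show False using quad by (simp add: power2_eq_square algebra_simps)
    qed
    have "lf * lg * r \<le> lf * lg * R" and "a * r \<le> a * R"
      using rR lg a by (auto intro: mult_left_mono)
    moreover have "0 \<le> M / 2 * r\<^sup>2" using M_pos by simp
    ultimately have "\<phi>star - f (g x) - lf * lg * R \<le> t" and "t \<le> c - f u + a * R"
      using t_ge Fc' by linarith+
    then show "y \<in> cball x R \<and> t \<in> {\<phi>star - f (g x) - lf * lg * R .. c - f u + a * R}"
      using rR by (simp add: r_def dist_norm norm_minus_commute)
  qed
  then have bounded: "bounded S"
    by (rule bounded_subset[rotated]) (simp add: bounded_Times)
  have F_cont: "continuous_on UNIV F"
  proof -
    have "continuous_on UNIV (\<lambda>p::(real ^ 'n) \<times> real. f (u + A *v (fst p - x)))"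
    proof (rule continuous_on_compose2[of UNIV f])
      show "continuous_on UNIV f" using f_lipschitz by (rule lipschitz_on_continuous_on)
      show "continuous_on UNIV (\<lambda>p::(real ^ 'n) \<times> real. u + A *v (fst p - x))"
        by (intro continuous_intros bounded_linear.continuous_on[OF matrix_vector_mul_bounded_linear])
    qed simp
    then show ?thesis
      unfolding F_def case_prod_beta by (intro continuous_intros)
  qed
  have "closed S"
    unfolding S_def
  proof (rule closed_Int)
    show "closed (epi h)" using h_ccp by (simp add: closed_convex_proper_def)
    show "closed {p. F p \<le> c}"
      using F_cont by (intro closed_Collect_le) auto
  qed
  with bounded have "compact S" by (simp add: compact_eq_bounded_closed)
  moreover have "(y0, t0) \<in> S" by (simp add: S_def epi_def t0 c_def)
  ultimately have "\<exists>q0\<in>S. \<forall>q\<in>S. F q0 \<le> F q"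
    by (intro continuous_attains_inf continuous_on_subset[OF F_cont]) auto
  then obtain p t where pt: "(p, t) \<in> S" and min: "\<forall>q\<in>S. F (p, t) \<le> F q"
    by auto
  \<comment> \<open>Membership in the epigraph only gives \<open>h p \<le> t\<close>, so this is an
    inequality.\<close>
  have p_le: "prox_model f h M u A x p \<le> ereal (F (p, t))"
    using pt by (cases "h p") (auto simp: S_def epi_def F_def prox_model_def)
  have "prox_model f h M u A x p \<le> prox_model f h M u A x y" for y
  proof (cases "h y = \<infinity>")
    case False
    then obtain s where s: "h y = ereal s" using h_real by blast
    have "F (p, t) \<le> F (y, s)"
    proof (cases "F (y, s) \<le> c")
      case True
      then show ?thesis using min by (auto simp: S_def epi_def s)
    next
      case False
      then show ?thesis using pt by (simp add: S_def)
    qed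
    then show ?thesis
      using order_trans[OF p_le, of "ereal (F (y, s))"] by (simp add: prox_model_def s F_def)
  qed (simp add: prox_model_def)
  then show ?thesis by blast
qed

section \<open>Decrease at the exact prox-linear point\<close>

definition prox_point :: "real ^ 'n \<Rightarrow> real ^ 'n" where
  "prox_point x = arg_min (prox_model f h M (g x) (J x) x) (\<lambda>_. True)"

text \<open>\<open>arg_min\<close> is a choice operator, so its minimizing property rests on the
  existence of a minimizer.\<close>

lemma prox_point_min:
  "prox_model f h M (g x) (J x) x (prox_point x) \<le> prox_model f h M (g x) (J x) x y"
proof -
  obtain p where "\<forall>y. prox_model f h M (g x) (J x) x p \<le> prox_model f h M (g x) (J x) x y"
    using prox_model_attains_min by blast
  then have "is_arg_min (prox_model f h M (g x) (J x) x) (\<lambda>_. True) p"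
    by (auto simp: is_arg_min_def not_less)
  then have "is_arg_min (prox_model f h M (g x) (J x) x) (\<lambda>_. True) (prox_point x)"
    unfolding prox_point_def arg_min_def by (rule someI)
  then show ?thesis by (auto simp: is_arg_min_def not_less)
qed

lemma norm_grad_map: "norm (grad_map f g J h M x) = M * norm (x - prox_point x)"
  using M_pos by (simp add: grad_map_def prox_point_def)

text \<open>A real-valued objective makes the estimates linear arithmetic. It agrees with
  \<open>composite\<close> where \<open>h\<close> is finite, hence the side conditions
  \<open>h x \<noteq> \<infinity>\<close>.\<close>

definition obj :: "real ^ 'n \<Rightarrow> real" where
  "obj x = f (g x) + real_of_ereal (h x)"

lemma composite_eq_obj: "h x \<noteq> \<infinity> \<Longrightarrow> composite f g h x = ereal (obj x)"
  using h_real[of x] by (metis composite_def obj_def plus_ereal.simps(1))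

lemma obj_ge: "h x \<noteq> \<infinity> \<Longrightarrow> \<phi>star \<le> obj x"
  using bounded_below[of x] by (simp add: composite_eq_obj)

text \<open>Comparing the model at \<open>prox_point x\<close> with its value at the midpoint of \<open>x\<close> and
  \<open>prox_point x\<close> gives half of the decrease that strong convexity provides.\<close>

lemma prox_point_decrease:
  assumes hx: "h x \<noteq> \<infinity>"
  defines "p \<equiv> prox_point x"
  shows "h p \<noteq> \<infinity>"
    and "f (g x + J x *v (p - x)) + real_of_ereal (h p) \<le> obj x - 3 * M / 4 * (norm (p - x))\<^sup>2"
proof -
  have x: "h x = ereal (real_of_ereal (h x))" using hx by (rule h_real)
  have "prox_model f h M (g x) (J x) x p \<le> prox_model f h M (g x) (J x) x x"
    unfolding p_def by (rule prox_point_min)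
  also have "\<dots> < \<infinity>" using x by (simp add: prox_model_def) (metis hx)
  finally show hp: "h p \<noteq> \<infinity>" by (auto simp: prox_model_def)
  obtain s where s: "h x = ereal s" using x by blast
  obtain t where t: "h p = ereal t" using h_real[OF hp] by blast
  define w where "w = (1/2) *\<^sub>R x + (1/2) *\<^sub>R p"
  have wx: "w - x = (1/2) *\<^sub>R (p - x)"
    by (simp add: w_def algebra_simps flip: scaleR_left_distrib)
  have hw: "h w \<le> ereal ((s + t) / 2)"
    unfolding w_def using closed_convex_proper_midpoint[OF h_ccp s t] .
  have "J x *v (w - x) = (1/2) *\<^sub>R (J x *v (p - x))"
    by (simp only: wx matrix_vector_mult_scaleR)
  then have "g x + J x *v (w - x) = (1 - 1/2) *\<^sub>R g x + (1/2) *\<^sub>R (g x + J x *v (p - x))"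
    by (simp add: vec_eq_iff field_simps)
  then have fw: "f (g x + J x *v (w - x)) \<le> (f (g x) + f (g x + J x *v (p - x))) / 2"
    using convex_onD[OF f_convex, of "1/2" "g x" "g x + J x *v (p - x)"] by simp
  have nw: "(norm (w - x))\<^sup>2 = (norm (p - x))\<^sup>2 / 4"
    by (simp add: wx power_divide)
  \<comment> \<open>Halving the step reduces the quadratic coefficient from M/2 to M/8. Cancelling
    half of the value at \<open>p\<close> and doubling turns the difference 3M/8 into 3M/4.\<close>
  have "prox_model f h M (g x) (J x) x p \<le> prox_model f h M (g x) (J x) x w"
    unfolding p_def by (rule prox_point_min)
  also have "\<dots> \<le> ereal ((f (g x) + f (g x + J x *v (p - x))) / 2) + ereal ((s + t) / 2)
      + ereal (M / 2 * ((norm (p - x))\<^sup>2 / 4))"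
    unfolding prox_model_def nw using fw hw by (intro add_mono) auto
  finally have "f (g x + J x *v (p - x)) + t + M / 2 * (norm (p - x))\<^sup>2
      \<le> (f (g x) + f (g x + J x *v (p - x))) / 2 + (s + t) / 2 + M / 2 * ((norm (p - x))\<^sup>2 / 4)"
    by (simp add: prox_model_def t)
  then show "f (g x + J x *v (p - x)) + real_of_ereal (h p)
      \<le> obj x - 3 * M / 4 * (norm (p - x))\<^sup>2"
    by (simp add: obj_def s t field_simps)
qed

section \<open>Descent along the iterates\<close>

text \<open>The inexact model at \<open>x'\<close> is compared with its value at the exact
  prox-linear point. Passing to the exact model at both points costs \<open>eg\<close> twice and
  \<open>ej\<close> once with each of \<open>d\<close> and \<open>D\<close>; the coefficient M/4 is
  3M/4 from \<open>prox_point_decrease\<close> minus M/2 from the model at that point.\<close>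

lemma descent:
  assumes hx: "h x \<noteq> \<infinity>"
    and sol: "prox_model f h M u A x x' \<le> (INF y. prox_model f h M u A x y) + ereal eb"
    and eg: "norm (u - g x) \<le> eg" and ej: "op_norm (A - J x) \<le> ej"
  defines "d \<equiv> norm (x' - x)" and "D \<equiv> norm (prox_point x - x)"
  shows "h x' \<noteq> \<infinity>"
    and "obj x' \<le> obj x - M / 4 * D\<^sup>2 - (M / 2 - lf * Lg) * d\<^sup>2
      + lf * (2 * eg + ej * (d + D)) + eb"
proof -
  define p where "p = prox_point x"
  have hp: "h p \<noteq> \<infinity>" and dec: "f (g x + J x *v (p - x)) + real_of_ereal (h p)
      \<le> obj x - 3 * M / 4 * D\<^sup>2"
    using prox_point_decrease[OF hx] by (auto simp: p_def D_def)
  obtain t where t: "h p = ereal t" using h_real[OF hp] by blast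
  have "(INF y. prox_model f h M u A x y) \<le> prox_model f h M u A x p"
    by (rule INF_lower) simp
  with sol have le: "prox_model f h M u A x x' \<le> prox_model f h M u A x p + ereal eb"
    by (meson add_right_mono order_trans)
  also have "\<dots> < \<infinity>" by (simp add: prox_model_def t)
  finally show hx': "h x' \<noteq> \<infinity>" by (auto simp: prox_model_def)
  obtain s where s: "h x' = ereal s" using h_real[OF hx'] by blast
  have le': "f (u + A *v (x' - x)) + s + M / 2 * d\<^sup>2 \<le> f (u + A *v (p - x)) + t + M / 2 * D\<^sup>2 + eb"
    using le by (simp add: prox_model_def t s d_def D_def flip: p_def)
  have err: "\<bar>f (u + A *v v) - f (g x + J x *v v)\<bar> \<le> lf * (eg + ej * norm v)" for v
  proof -
    have "(u + A *v v) - (g x + J x *v v) = (u - g x) + (A - J x) *v v"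
      by (simp add: matrix_vector_mult_diff_rdistrib)
    then have "norm ((u + A *v v) - (g x + J x *v v)) \<le> norm (u - g x) + norm ((A - J x) *v v)"
      by (metis norm_triangle_ineq)
    also have "\<dots> \<le> eg + ej * norm v"
      using eg norm_mult_vec_le[of "A - J x" v] mult_right_mono[OF ej norm_ge_zero[of v]]
      by linarith
    finally show ?thesis
      using f_lipschitzD[of "u + A *v v" "g x + J x *v v"] lf_pos
      by (meson mult_left_mono less_imp_le order_trans)
  qed
  have taylor: "f (g x') \<le> f (g x + J x *v (x' - x)) + lf * Lg * d\<^sup>2"
  proof -
    have "f (g x') - f (g x + J x *v (x' - x)) \<le> lf * norm (g x' - (g x + J x *v (x' - x)))"
      using f_lipschitzD[of "g x'" "g x + J x *v (x' - x)"] by linarith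
    also have "\<dots> \<le> lf * (Lg * d\<^sup>2)"
      unfolding d_def using linearization_error lf_pos by (intro mult_left_mono) auto
    finally show ?thesis by simp
  qed
  have "f (g x + J x *v (x' - x)) \<le> f (u + A *v (x' - x)) + lf * (eg + ej * d)"
    using err[of "x' - x"] by (simp add: d_def)
  moreover have "f (u + A *v (p - x)) \<le> f (g x + J x *v (p - x)) + lf * (eg + ej * D)"
    using err[of "p - x"] by (simp add: D_def p_def)
  moreover have "obj x' = f (g x') + s" by (simp add: obj_def s)
  ultimately show "obj x' \<le> obj x - M / 4 * D\<^sup>2 - (M / 2 - lf * Lg) * d\<^sup>2
      + lf * (2 * eg + ej * (d + D)) + eb"
    using le' dec taylor by (simp add: t algebra_simps)
qed

text \<open>The deterministic core, for one fixed sample point: \<open>epoch_descent\<close> with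
  \<open>L = lf * Lg\<close> absorbs the drift in each epoch, and \<open>link\<close> makes the
  objective telescope across epochs.\<close>

lemma iterates_descent:
  fixes x :: "nat \<Rightarrow> nat \<Rightarrow> real ^ 'n" and n :: "nat \<Rightarrow> nat"
  assumes h0: "h (x 0 0) \<noteq> \<infinity>" and link: "\<And>k. x (Suc k) 0 = x k (n k)"
    and sol: "\<And>k i. k < K \<Longrightarrow> i < n k \<Longrightarrow> prox_model f h M (u k i) (A k i) (x k i) (x k (Suc i))
      \<le> (INF y. prox_model f h M (u k i) (A k i) (x k i) y) + ereal eb"
    and est_g: "\<And>k i. k < K \<Longrightarrow> i < n k \<Longrightarrow> norm (u k i - g (x k i))
      \<le> c0 + c1 * norm (x k i - x k 0) + c2 * (norm (x k i - x k 0))\<^sup>2"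
    and est_J: "\<And>k i. k < K \<Longrightarrow> i < n k \<Longrightarrow> op_norm (A k i - J (x k i))
      \<le> l0 + l1 * norm (x k i - x k 0)"
    and T_pos: "0 < T" and T: "\<And>k. k < K \<Longrightarrow> real (n k) \<le> T"
    and c2: "T\<^sup>2 * c2 \<le> 6 * Lg / 25" and l1: "T\<^sup>2 * l1\<^sup>2 \<le> 6 * Lg\<^sup>2 / 19"
  defines "c \<equiv> lf * (2 * c0 + 2 * (T\<^sup>2 * c1\<^sup>2) / Lg + 2 * l0\<^sup>2 / Lg) + eb"
  shows "(\<Sum>k<K. \<Sum>i<n k. 3 * M / 20 * (norm (x k i - prox_point (x k i)))\<^sup>2)
    \<le> obj (x 0 0) - \<phi>star + real (\<Sum>k<K. n k) * c"
proof -
  let ?D = "\<lambda>k i. 3 * M / 20 * (norm (x k i - prox_point (x k i)))\<^sup>2"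
  have step: "h (x k (Suc i)) \<noteq> \<infinity> \<and> obj (x k (Suc i)) \<le> obj (x k i) + c - ?D k i
      + lf * Lg * (2 * (norm (x k i - x k 0))\<^sup>2 / T\<^sup>2 - (norm (x k (Suc i) - x k i))\<^sup>2)"
    if k: "k < K" and i: "i < n k" and h: "h (x k i) \<noteq> \<infinity>" for k i
  proof -
    define r where "r = norm (x k i - x k 0)"
    define d where "d = norm (x k (Suc i) - x k i)"
    define D where "D = norm (prox_point (x k i) - x k i)"
    note desc = descent[OF h sol[OF k i] est_g[OF k i] est_J[OF k i], folded r_def d_def D_def]
    have "lf * (2 * (c0 + c1 * r + c2 * r\<^sup>2) + (l0 + l1 * r) * (d + D))
      \<le> lf * (2 * c0 + 2 * (T\<^sup>2 * c1\<^sup>2) / Lg + 2 * l0\<^sup>2 / Lg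
        + Lg * (2 * r\<^sup>2 / T\<^sup>2 + d\<^sup>2 / 2 + D\<^sup>2 / 2))"
      using lf_pos error_terms_le[OF Lg_pos T_pos c2 l1] by (intro mult_left_mono) auto
    also have "\<dots> = c - eb + lf * Lg * (2 * r\<^sup>2 / T\<^sup>2) + lf * Lg / 2 * d\<^sup>2 + lf * Lg / 2 * D\<^sup>2"
      by (simp add: c_def algebra_simps)
    finally have "obj (x k (Suc i)) \<le> obj (x k i) + c + lf * Lg * (2 * r\<^sup>2 / T\<^sup>2)
        - (M / 4 - lf * Lg / 2) * D\<^sup>2 - (M / 2 - 3 / 2 * (lf * Lg)) * d\<^sup>2"
      using desc(2) by (simp add: algebra_simps)
    \<comment> \<open>This coefficient comparison and the next one both amount to
      \<open>5 * lf * Lg \<le> M\<close>; this is the threshold in the hypothesis on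
      \<open>M\<close>.\<close>
    moreover have "3 * M / 20 * D\<^sup>2 \<le> (M / 4 - lf * Lg / 2) * D\<^sup>2"
      by (intro mult_right_mono) (use M_gt in linarith, simp)
    moreover have "lf * Lg * d\<^sup>2 \<le> (M / 2 - 3 / 2 * (lf * Lg)) * d\<^sup>2"
      by (intro mult_right_mono) (use M_gt in linarith, simp)
    ultimately show ?thesis
      using desc(1) by (simp add: r_def d_def D_def norm_minus_commute right_diff_distrib)
  qed
  have epoch: "h (x k (n k)) \<noteq> \<infinity> \<and>
      obj (x k (n k)) + (\<Sum>i<n k. ?D k i) \<le> obj (x k 0) + real (n k) * c"
    if k: "k < K" and h: "h (x k 0) \<noteq> \<infinity>" for k
  proof
    \<comment> \<open>Each step preserves finiteness of \<open>h\<close>, which the descent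
      inequality at the next iterate requires.\<close>
    have fin: "h (x k i) \<noteq> \<infinity>" if "i \<le> n k" for i
      using that by (induction i) (use h step[OF k] in auto)
    then show "h (x k (n k)) \<noteq> \<infinity>" by simp
    show "obj (x k (n k)) + (\<Sum>i<n k. ?D k i) \<le> obj (x k 0) + real (n k) * c"
    proof (rule epoch_descent[where L = "lf * Lg" and T = T and x = "x k"])
      show "0 \<le> lf * Lg" using lf_pos Lg_pos by simp
    qed (use step[OF k] fin T[OF k] in auto)
  qed
  have "h (x j 0) \<noteq> \<infinity> \<and>
      obj (x j 0) + (\<Sum>k<j. \<Sum>i<n k. ?D k i) \<le> obj (x 0 0) + real (\<Sum>k<j. n k) * c"
    if "j \<le> K" for j
    using that
  proof (induction j)
    case 0
    then show ?case using h0 by simp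
  next
    case (Suc j)
    then show ?case using epoch[of j] by (simp add: link distrib_right)
  qed
  from this[of K] obj_ge[of "x K 0"] show ?thesis by simp
qed

end

section \<open>The probabilistic conclusion\<close>

lemma sum_list_eq_sum_nth_lessThan: "sum_list xs = (\<Sum>k<length xs. xs ! k)"
  by (simp add: sum_list_sum_nth atLeast0LessThan)

lemma idx_eq_Sigma: "idx K \<tau> = Sigma {..<K} (\<lambda>k. {..<\<tau> ! k})"
  by (auto simp: idx_def)

theorem theorem3p1:
  fixes f :: "real ^ 'm \<Rightarrow> real" and g :: "real ^ 'n \<Rightarrow> real ^ 'm"
    and J :: "real ^ 'n \<Rightarrow> real ^ 'n ^ 'm" and h :: "real ^ 'n \<Rightarrow> ereal"
    and lf lg Lg M \<Delta> \<epsilon> eb db :: real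
    and P :: "'w measure"
    and Or :: "('w, 'th, 'mem, 'r, 's, 'n, 'm) oracles"
    and \<Theta> :: "'th set" and C :: "nat \<Rightarrow> nat list \<Rightarrow> real \<Rightarrow> 'th set"
    and \<gamma>0 \<gamma>1 \<gamma>2 lam0 lam1 :: "nat \<Rightarrow> nat list \<Rightarrow> 'th \<Rightarrow> real \<Rightarrow> real"
    and x00 :: "real ^ 'n" and K :: nat and \<tau> :: "nat list" and \<theta> :: 'th
  defines "\<Phi> \<equiv> composite f g h"
  defines "\<Phi>star \<equiv> (INF x. \<Phi> x)"
  defines "\<Sigma>\<tau> \<equiv> sum_list \<tau>"
  defines "\<tau>max \<equiv> Max (set \<tau>)"
  assumes "convex_on UNIV f" and "lf-lipschitz_on UNIV f"
    and "lg-lipschitz_on UNIV g"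
    and "\<And>x. (g has_derivative (\<lambda>v. J x *v v)) (at x)"
    and "\<And>x y. op_norm (J x - J y) \<le> Lg * norm (x - y)"
    and "closed_convex_proper h"
    and "lf > 0" and "Lg > 0"
    and "prob_space P"
    and "eb > 0" and "db > 0"
    and "estimation_error_assumption P f g J h M Or eb db x00 \<Theta> C \<gamma>0 \<gamma>1 \<gamma>2 lam0 lam1"
    and "solver_assumption P f h M Or x00 \<Theta>"
    and "\<Phi>star > -\<infinity>"
    and "M > 5 * lf * Lg"
    and "0 < \<Delta>" and "\<Delta> < 1" and "\<epsilon> > 0"
    and "K > 0" and "\<tau> \<in> epoch_lengths K"
    and "\<theta> \<in> C K \<tau> (\<Delta> / 2)"
    and "db \<le> \<Delta> / (2 * real \<Sigma>\<tau>)"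
    and "eb \<le> \<epsilon> / (5 * 30 * M)"
    and "ereal (real \<Sigma>\<tau>) \<ge> ereal (5 * 30 * M) * (\<Phi> x00 - \<Phi>star) / ereal \<epsilon>"
    and "\<gamma>0 K \<tau> \<theta> (\<Delta> / 2) \<le> \<epsilon> / (5 * 125 * lf * M)"
    and "(lam0 K \<tau> \<theta> (\<Delta> / 2))\<^sup>2 \<le> Lg * \<epsilon> / (5 * 95 * lf * M)"
    and "(real \<tau>max)\<^sup>2 * (\<gamma>1 K \<tau> \<theta> (\<Delta> / 2))\<^sup>2 \<le> Lg * \<epsilon> / (5 * 135 * lf * M)"
    and "(real \<tau>max)\<^sup>2 * \<gamma>2 K \<tau> \<theta> (\<Delta> / 2) \<le> 6 * Lg / 25"
    and "(real \<tau>max)\<^sup>2 * (lam1 K \<tau> \<theta> (\<Delta> / 2))\<^sup>2 \<le> 6 * Lg\<^sup>2 / 19"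
  shows "with_prob_ge P (1 - \<Delta>) (\<lambda>\<omega>.
           1 / real \<Sigma>\<tau> *
             (\<Sum>k<K. \<Sum>i<\<tau> ! k.
                (norm (grad_map f g J h M (iterate f h M Or eb db x00 \<tau> \<theta> \<omega> k i)))\<^sup>2) \<le> \<epsilon>)"
proof -
  let ?x = "iterate f h M Or eb db x00 \<tau> \<theta>"
  let ?e = "estimates f h M Or eb db x00 \<tau> \<theta>"
  let ?c0 = "\<gamma>0 K \<tau> \<theta> (\<Delta> / 2)" and ?c1 = "\<gamma>1 K \<tau> \<theta> (\<Delta> / 2)" and ?c2 = "\<gamma>2 K \<tau> \<theta> (\<Delta> / 2)"
  let ?l0 = "lam0 K \<tau> \<theta> (\<Delta> / 2)" and ?l1 = "lam1 K \<tau> \<theta> (\<Delta> / 2)"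
  let ?T = "real \<tau>max"
  have [simp]: "0 < lf" "0 < Lg" "0 < \<epsilon>" "0 \<le> \<epsilon>" "\<epsilon> \<noteq> 0"
    using \<open>lf > 0\<close> \<open>Lg > 0\<close> \<open>\<epsilon> > 0\<close> by auto
  have M: "0 < M" using \<open>M > 5 * lf * Lg\<close> mult_pos_pos[OF \<open>lf > 0\<close> \<open>Lg > 0\<close>] by linarith
  have len: "length \<tau> = K" and \<tau>_pos: "\<And>t. t \<in> set \<tau> \<Longrightarrow> 0 < t"
    using \<open>\<tau> \<in> epoch_lengths K\<close> by (auto simp: epoch_lengths_def)
  have \<Sigma>_eq: "\<Sigma>\<tau> = (\<Sum>k<K. \<tau> ! k)"
    by (simp add: \<Sigma>\<tau>_def sum_list_eq_sum_nth_lessThan len)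
  have nth_le: "real (\<tau> ! k) \<le> ?T" if "k < K" for k
    using that len by (simp add: \<tau>max_def)
  have "\<tau> ! 0 \<in> set \<tau>" using \<open>K > 0\<close> len by simp
  then have nth0: "0 < \<tau> ! 0" by (rule \<tau>_pos)
  have T_pos: "0 < ?T" using nth_le[OF \<open>K > 0\<close>] nth0 by linarith
  have "\<tau> ! 0 \<le> \<Sigma>\<tau>"
    unfolding \<Sigma>_eq using \<open>K > 0\<close> by (intro member_le_sum) auto
  with nth0 have \<Sigma>_pos: "0 < real \<Sigma>\<tau>" by simp

  \<comment> \<open>Properness makes the infimum less than \<infinity>; with
    \<open>\<Phi>star > -\<infinity>\<close> it is a real number.\<close>
  obtain y0 where "h y0 \<noteq> \<infinity>"
    using \<open>closed_convex_proper h\<close> by (auto simp: closed_convex_proper_def)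
  then have "\<Phi> y0 \<noteq> \<infinity>" by (simp add: \<Phi>_def composite_def)
  moreover have "\<Phi>star \<le> \<Phi> y0" unfolding \<Phi>star_def by (rule INF_lower) simp
  ultimately obtain \<phi>star where \<phi>star: "\<Phi>star = ereal \<phi>star"
    using \<open>\<Phi>star > -\<infinity>\<close> by (cases \<Phi>star) auto
  interpret prox_linear f g J h lf lg Lg M \<phi>star
  proof
    show "ereal \<phi>star \<le> composite f g h x" for x
      unfolding \<phi>star[symmetric] \<Phi>star_def \<Phi>_def by (rule INF_lower) simp
  qed (use assms in auto)

  have \<Phi>_gap: "ereal (5 * 30 * M) * (\<Phi> x00 - \<Phi>star) / ereal \<epsilon> \<le> ereal (real \<Sigma>\<tau>)" by fact
  \<comment> \<open>An infinite value at the start would make the required lower bound on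
    \<open>\<Sigma>\<tau>\<close> infinite.\<close>
  have h00: "h x00 \<noteq> \<infinity>"
  proof
    assume "h x00 = \<infinity>"
    then have "\<Phi> x00 = \<infinity>" by (simp add: \<Phi>_def composite_def)
    with \<Phi>_gap show False using M by (simp add: \<phi>star)
  qed
  then have "\<Phi> x00 = ereal (obj x00)" unfolding \<Phi>_def by (rule composite_eq_obj)
  with \<Phi>_gap have "5 * 30 * M * (obj x00 - \<phi>star) / \<epsilon> \<le> real \<Sigma>\<tau>"
    by (simp add: \<phi>star)
  then have gap: "obj x00 - \<phi>star \<le> real \<Sigma>\<tau> * (1 / 150 * (\<epsilon> / M))"
    using M by (simp add: field_simps)

  have C_sub: "C K \<tau> (\<Delta> / 2) \<subseteq> \<Theta>" and
    est: "with_prob_ge P (1 - \<Delta> / 2) (\<lambda>\<omega>. \<forall>(k, i) \<in> idx K \<tau>.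
      let x = ?x \<omega> k i; z = ?x \<omega> k 0; (u, A) = ?e \<omega> k i
      in norm (u - g x) \<le> ?c0 + ?c1 * norm (x - z) + ?c2 * (norm (x - z))\<^sup>2 \<and>
         op_norm (A - J x) \<le> ?l0 + ?l1 * norm (x - z))"
    (is "with_prob_ge P _ ?Est")
    using assms(16)[unfolded estimation_error_assumption_def, rule_format, of K \<tau> "\<Delta> / 2"]
      \<open>K > 0\<close> \<open>\<tau> \<in> epoch_lengths K\<close> \<open>0 < \<Delta>\<close> \<open>\<Delta> < 1\<close> \<open>\<theta> \<in> C K \<tau> (\<Delta> / 2)\<close> by auto
  let ?Sol = "\<lambda>\<omega> (k, i). let s = subproblem f h M Or eb db x00 \<tau> \<theta> \<omega> k i
    in s (solver Or s eb db (sol_seed Or k i \<omega>)) \<le> (INF x. s x) + ereal eb"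
  have "\<theta> \<in> \<Theta>" using C_sub \<open>\<theta> \<in> C K \<tau> (\<Delta> / 2)\<close> by blast
  then have "with_prob_ge P (1 - db) (\<lambda>\<omega>. ?Sol \<omega> q)" if "q \<in> idx K \<tau>" for q
    using assms(17)[unfolded solver_assumption_def, rule_format, OF \<open>eb > 0\<close> \<open>db > 0\<close> \<open>K > 0\<close>
        \<open>\<tau> \<in> epoch_lengths K\<close> _ that]
    by (simp add: case_prod_beta)
  moreover have "finite (idx K \<tau>)" by (simp add: idx_eq_Sigma)
  ultimately have "with_prob_ge P (1 - real (card (idx K \<tau>)) * db) (\<lambda>\<omega>. \<forall>q\<in>idx K \<tau>. ?Sol \<omega> q)"
    using \<open>prob_space P\<close> by (intro with_prob_ge_Ball)
  moreover have "card (idx K \<tau>) = \<Sigma>\<tau>" by (simp add: idx_eq_Sigma \<Sigma>_eq)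
  ultimately have sol: "with_prob_ge P (1 - real \<Sigma>\<tau> * db) (\<lambda>\<omega>. \<forall>q\<in>idx K \<tau>. ?Sol \<omega> q)"
    by simp
  \<comment> \<open>The failure budget \<Delta> is split in half: one half for the estimator, the
    other for all \<open>\<Sigma>\<tau>\<close> solver calls together.\<close>
  have "real \<Sigma>\<tau> * db \<le> \<Delta> / 2"
    using \<open>db \<le> \<Delta> / (2 * real \<Sigma>\<tau>)\<close> \<Sigma>_pos by (simp add: field_simps)
  then have prob: "1 - \<Delta> \<le> (1 - \<Delta> / 2) + (1 - real \<Sigma>\<tau> * db) - 1" by simp

  define c where "c = lf * (2 * ?c0 + 2 * (?T\<^sup>2 * ?c1\<^sup>2) / Lg + 2 * ?l0\<^sup>2 / Lg) + eb"
  \<comment> \<open>The four contributions are 2/625 + 2/675 + 2/475 + 1/150 < 1/50, in units of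
    \<open>\<epsilon> / M\<close>.\<close>
  have c: "c \<le> 1 / 50 * (\<epsilon> / M)"
  proof -
    have "lf * ?c0 \<le> 1 / 625 * (\<epsilon> / M)"
      using assms(29) M by (simp add: field_simps)
    moreover have "lf * (?T\<^sup>2 * ?c1\<^sup>2) / Lg \<le> 1 / 675 * (\<epsilon> / M)"
      using assms(31) M by (simp add: field_simps)
    moreover have "lf * ?l0\<^sup>2 / Lg \<le> 1 / 475 * (\<epsilon> / M)"
      using assms(30) M by (simp add: field_simps)
    moreover have "eb \<le> 1 / 150 * (\<epsilon> / M)"
      using assms(27) M by (simp add: field_simps)
    moreover have "0 < \<epsilon> / M" using M by simp
    ultimately show ?thesis by (simp add: c_def algebra_simps)
  qed

  show ?thesis
  proof (rule with_prob_ge_mono[OF with_prob_ge_conj[OF \<open>prob_space P\<close> est sol] prob])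
    fix \<omega> assume \<omega>: "?Est \<omega> \<and> (\<forall>q\<in>idx K \<tau>. ?Sol \<omega> q)"
    let ?D = "\<lambda>k i. (norm (?x \<omega> k i - prox_point (?x \<omega> k i)))\<^sup>2"
    let ?S = "\<Sum>k<K. \<Sum>i<\<tau> ! k. ?D k i"
    \<comment> \<open>On the good event the trajectory satisfies the hypotheses of
      \<open>iterates_descent\<close>, with \<open>T\<close> the longest epoch length.\<close>
    have "(\<Sum>k<K. \<Sum>i<\<tau> ! k. 3 * M / 20 * ?D k i)
      \<le> obj (?x \<omega> 0 0) - \<phi>star + real (\<Sum>k<K. \<tau> ! k) * c"
      unfolding c_def
    proof (rule iterates_descent[where u = "\<lambda>k i. fst (?e \<omega> k i)" and A = "\<lambda>k i. snd (?e \<omega> k i)"])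
      show "h (?x \<omega> 0 0) \<noteq> \<infinity>" using h00 by (simp add: iterate_0_0)
      fix k i assume "k < K" "i < \<tau> ! k"
      then have "(k, i) \<in> idx K \<tau>" by (simp add: idx_def)
      then show
        "prox_model f h M (fst (?e \<omega> k i)) (snd (?e \<omega> k i)) (?x \<omega> k i) (?x \<omega> k (Suc i))
          \<le> (INF y. prox_model f h M (fst (?e \<omega> k i)) (snd (?e \<omega> k i)) (?x \<omega> k i) y) + ereal eb"
        "norm (fst (?e \<omega> k i) - g (?x \<omega> k i)) \<le> ?c0 + ?c1 * norm (?x \<omega> k i - ?x \<omega> k 0)
          + ?c2 * (norm (?x \<omega> k i - ?x \<omega> k 0))\<^sup>2"
        "op_norm (snd (?e \<omega> k i) - J (?x \<omega> k i)) \<le> ?l0 + ?l1 * norm (?x \<omega> k i - ?x \<omega> k 0)"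
        using \<omega> by (fastforce simp: iterate_Suc subproblem_eq Let_def case_prod_beta)+
    qed (use T_pos nth_le assms in \<open>auto simp: iterate_Suc_0\<close>)
    then have "3 * M / 20 * ?S \<le> obj x00 - \<phi>star + real \<Sigma>\<tau> * c"
      by (simp add: iterate_0_0 \<Sigma>_eq sum_distrib_left)
    also have "\<dots> \<le> real \<Sigma>\<tau> * (1 / 150 * (\<epsilon> / M)) + real \<Sigma>\<tau> * (1 / 50 * (\<epsilon> / M))"
      by (intro add_mono gap mult_left_mono c) simp
    \<comment> \<open>The value 3/20 matches the factor on the left; multiplying by 20M/3 then
      leaves \<open>M\<^sup>2 * ?S\<close>, the sum of the squared norms of the gradient
      mapping.\<close>
    also have "\<dots> \<le> 3 / 20 * (real \<Sigma>\<tau> * (\<epsilon> / M))"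
      using M by (simp add: field_simps)
    finally have "M\<^sup>2 * ?S \<le> real \<Sigma>\<tau> * \<epsilon>"
      using M by (simp add: field_simps power2_eq_square)
    then show "1 / real \<Sigma>\<tau> * (\<Sum>k<K. \<Sum>i<\<tau> ! k. (norm (grad_map f g J h M (?x \<omega> k i)))\<^sup>2) \<le> \<epsilon>"
      using \<Sigma>_pos
      by (simp add: norm_grad_map power_mult_distrib field_simps flip: sum_distrib_left)
  qed
qed

end
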